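(* Let $\phi^\theta$ denote the rotation of $\mathbb{R}^2$ of angle $\theta$. For any constant $C(\theta)$ (allowed to depend on $\theta$), there exist some $p>2$ and some $F\in\mathrm{BMO}(\mathbb{R}^2)\cap W^{1,p}(\mathbb{R}^2)$ such that for any $\epsilon(\theta,p)<1$ the following two conditions cannot hold simultaneously: (1) $\displaystyle\lim_{\theta\to 0}\epsilon(\theta,p)=0$; (2) the inequality $$\|F\circ\phi^\theta\|_{\mathrm{BMO}(\mathbb{R}^2)}\le C(\theta)\,\|F\|_{\mathrm{BMO}(\mathbb{R}^2)}+\epsilon(\theta,p)\,\|F\|_{W^{1,p}(\mathbb{R}^2)}$$ is valid for every $\theta$.
   Context: $\mathrm{BMO}(\mathbb{R}^2)$ denotes the biparameter (Chang–Fefferman, product) BMO space, defined as follows. Let $\mathbb{D}=\mathbb{D}^0=\{2^k[j,j+1): j,k\in\mathbb{Z}\}$. For $\delta_0\in\mathbb{R}$ let $\mathbb{D}^{\delta_0}=\{\delta_I+I: I\in\mathbb{D}\}$, where $\delta_I=\delta_0$ if $|I|\le 1$, $\delta_I=\delta_0+\frac13(|I|-1)$ if $|I|=2^k$ with $k>0$ even, and $\delta_I=\delta_0+\frac13(2|I|-1)$ if $|I|=2^k$ with $k>0$ odd. For an interval $I=[a,b)$ the Haar wavelet is $h_I=|I|^{-1/2}\big(\mathbf{1}_{[a,\frac{a+b}{2})}-\mathbf{1}_{[\frac{a+b}{2},b)}\big)$. For $a,b\in\{0,\delta_0\}$ and $F\in L^2_{loc}(\mathbb{R}^2)$, $$\|F\|_{\mathrm{BMO}^{a,b}(\mathbb{R}^2)}=\sup_{\Omega}\Big(\frac{1}{|\Omega|}\sum_{\substack{I\in\mathbb{D}^a,\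 J\in\mathbb{D}^b\\ I\times J\subset\Omega}}|\langle F,h_I\otimes h_J\rangle|^2\Big)^{1/2},$$ the supremum being over all (nonempty) open sets $\Omega\subset\mathbb{R}^2$ of finite measure. A parameter $\delta_0\in(0,1/2)$ is fixed once and for all such that the product BMO space is the intersection of the four dyadic spaces: $\mathrm{BMO}(\mathbb{R}^2)=\bigcap_{a,b\in\{0,\delta_0\}}\mathrm{BMO}^{a,b}(\mathbb{R}^2)$, with $\|F\|_{\mathrm{BMO}(\mathbb{R}^2)}=\sup_{a,b\in\{0,\delta_0\}}\|F\|_{\mathrm{BMO}^{a,b}(\mathbb{R}^2)}$; this is taken as the definition. (It is a pseudo-norm.) $W^{1,p}(\mathbb{R}^2)$ is the usual Sobolev space, $\|F\|_{W^{1,p}}=\|F\|_p+\|\partial_xF\|_p+\|\partial_yF\|_p$. The rotation $\phi^\theta$ is the linear map with matrix $\begin{bmatrix}\cos\theta&-\sin\theta\\ \sin\theta&\cos\theta\end{bmatrix}$. Here $\theta\mapsto C(\theta)$ and $\theta\mapsto\epsilon(\theta,p)$ are quantities depending on the angle. *)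

theory Defs
  imports "HOL-Probability.Essential_Supremum"
begin

text \<open>Functions on the plane are real-valued maps on \<open>real \<times> real\<close>. Measurability and integrals
  refer to Lebesgue measure, and norms take values in \<open>ennreal\<close>.\<close>

definition epowr :: "ennreal \<Rightarrow> real \<Rightarrow> ennreal" where
  "epowr x r = (if x = \<infinity> then \<infinity> else ennreal (enn2real x powr r))"

text \<open>A half-open interval \<open>[a,b)\<close> is represented by the pair \<open>(a,b)\<close> of its endpoints.\<close>

definition dyadic :: "(real \<times> real) set" where
  "dyadic = {(2 powi k * of_int j, 2 powi k * (of_int j + 1)) | j k :: int. True}"

text \<open>\<open>dyadic_shift \<delta> k\<close> is the translation amount \<open>\<delta>\<^sub>I\<close> for the intervals of length \<open>2 powi k\<close>.\<close>

definition dyadic_shift :: "real \<Rightarrow> int \<Rightarrow> real" where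
  "dyadic_shift \<delta> k =
     (if k \<le> 0 then \<delta>
      else if even k then \<delta> + (2 powi k - 1) / 3
      else \<delta> + (2 * 2 powi k - 1) / 3)"

text \<open>The notation \<open>D\<^sup>0\<close> stands for the standard, unshifted dyadic grid, which is not what the
  translation formula would give for \<open>\<delta> = 0\<close>.\<close>

definition dyadic_grid :: "real \<Rightarrow> (real \<times> real) set" where
  "dyadic_grid \<delta> =
     (if \<delta> = 0 then dyadic
      else {(dyadic_shift \<delta> k + 2 powi k * of_int j,
             dyadic_shift \<delta> k + 2 powi k * (of_int j + 1)) | j k :: int. True})"

definition haar :: "real \<times> real \<Rightarrow> real \<Rightarrow> real" where
  "haar I x = (case I of (a, b) \<Rightarrow>
     (indicator {a..<(a + b) / 2} x - indicator {(a + b) / 2..<b} x) / sqrt (b - a))"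

definition haar_coeff :: "(real \<times> real \<Rightarrow> real) \<Rightarrow> real \<times> real \<Rightarrow> real \<times> real \<Rightarrow> real" where
  "haar_coeff F I J = (LINT z|lebesgue. F z * (haar I (fst z) * haar J (snd z)))"

definition L2_loc :: "(real \<times> real \<Rightarrow> real) set" where
  "L2_loc = {F. F \<in> borel_measurable lebesgue \<and>
                (\<forall>K. compact K \<longrightarrow> set_integrable lebesgue K (\<lambda>z. (F z)\<^sup>2))}"

definition BMO_dyadic_norm :: "real \<Rightarrow> real \<Rightarrow> (real \<times> real \<Rightarrow> real) \<Rightarrow> ennreal" where
  "BMO_dyadic_norm a b F =
     (SUP \<Omega> \<in> {\<Omega>. open \<Omega> \<and> \<Omega> \<noteq> {} \<and> emeasure lebesgue \<Omega> < \<infinity>}.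
        epowr ((\<Sum>\<^sub>\<infinity>(I, J) \<in> {(I, J). I \<in> dyadic_grid a \<and> J \<in> dyadic_grid b \<and>
                                  {fst I..<snd I} \<times> {fst J..<snd J} \<subseteq> \<Omega>}.
                  ennreal (\<bar>haar_coeff F I J\<bar>\<^sup>2)) / emeasure lebesgue \<Omega>) (1 / 2))"

definition BMO_norm :: "real \<Rightarrow> (real \<times> real \<Rightarrow> real) \<Rightarrow> ennreal" where
  "BMO_norm \<delta>\<^sub>0 F = (SUP (a, b) \<in> {0, \<delta>\<^sub>0} \<times> {0, \<delta>\<^sub>0}. BMO_dyadic_norm a b F)"

definition BMO :: "real \<Rightarrow> (real \<times> real \<Rightarrow> real) set" where
  "BMO \<delta>\<^sub>0 = {F \<in> L2_loc. BMO_norm \<delta>\<^sub>0 F < \<infinity>}"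

text \<open>The exponent of \<open>L\<^sup>p\<close> ranges over \<open>[1,\<infinity>]\<close>.\<close>

definition Lp_norm :: "ennreal \<Rightarrow> (real \<times> real \<Rightarrow> real) \<Rightarrow> ennreal" where
  "Lp_norm p F =
     (if p = \<infinity> then esssup lebesgue (\<lambda>z. ennreal \<bar>F z\<bar>)
      else epowr (\<integral>\<^sup>+ z. ennreal (\<bar>F z\<bar> powr enn2real p) \<partial>lebesgue) (1 / enn2real p))"

definition Lp :: "ennreal \<Rightarrow> (real \<times> real \<Rightarrow> real) set" where
  "Lp p = {F \<in> borel_measurable lebesgue. Lp_norm p F < \<infinity>}"

primrec Ck :: "nat \<Rightarrow> (real \<times> real \<Rightarrow> real) \<Rightarrow> bool" where
  "Ck 0 f \<longleftrightarrow> continuous_on UNIV f"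
| "Ck (Suc k) f \<longleftrightarrow>
     (\<exists>fx fy. (\<forall>z. (f has_derivative (\<lambda>h. fst h * fx z + snd h * fy z)) (at z)) \<and> Ck k fx \<and> Ck k fy)"

definition test_function :: "(real \<times> real \<Rightarrow> real) \<Rightarrow> bool" where
  "test_function \<psi> \<longleftrightarrow> (\<forall>k. Ck k \<psi>) \<and> compact (closure {z. \<psi> z \<noteq> 0})"

definition L1_loc :: "(real \<times> real \<Rightarrow> real) set" where
  "L1_loc = {F. F \<in> borel_measurable lebesgue \<and> (\<forall>K. compact K \<longrightarrow> set_integrable lebesgue K F)}"

text \<open>\<open>G\<close> is the distributional derivative of \<open>F\<close> in the direction \<open>e\<close>.\<close>

definition has_weak_partial ::
    "(real \<times> real \<Rightarrow> real) \<Rightarrow> real \<times> real \<Rightarrow> (real \<times> real \<Rightarrow> real) \<Rightarrow> bool" where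
  "has_weak_partial F e G \<longleftrightarrow> F \<in> L1_loc \<and> G \<in> L1_loc \<and>
     (\<forall>\<psi>. test_function \<psi> \<longrightarrow>
        (LINT z|lebesgue. F z * frechet_derivative \<psi> (at z) e) = - (LINT z|lebesgue. G z * \<psi> z))"

text \<open>Weak derivatives are unique almost everywhere, so the choice of a representative affects
  neither membership in \<open>L\<^sup>p\<close> nor the norm.\<close>

definition weak_partial :: "real \<times> real \<Rightarrow> (real \<times> real \<Rightarrow> real) \<Rightarrow> real \<times> real \<Rightarrow> real" where
  "weak_partial e F = (SOME G. has_weak_partial F e G)"

definition W1p :: "ennreal \<Rightarrow> (real \<times> real \<Rightarrow> real) set" where
  "W1p p = {F \<in> Lp p. \<forall>e \<in> {(1, 0), (0, 1)}. \<exists>G \<in> Lp p. has_weak_partial F e G}"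

text \<open>Only meaningful for \<open>F \<in> W1p p\<close>.\<close>

definition W1p_norm :: "ennreal \<Rightarrow> (real \<times> real \<Rightarrow> real) \<Rightarrow> ennreal" where
  "W1p_norm p F =
     Lp_norm p F + Lp_norm p (weak_partial (1, 0) F) + Lp_norm p (weak_partial (0, 1) F)"

definition rot :: "real \<Rightarrow> real \<times> real \<Rightarrow> real \<times> real" where
  "rot \<theta> z = (cos \<theta> * fst z - sin \<theta> * snd z, sin \<theta> * fst z + cos \<theta> * snd z)"

end

theory Submission
  imports Defs "HOL-Real_Asymp.Real_Asymp"
begin

text \<open>Since \<open>\<parallel>\<cdot>\<parallel>\<close> on product BMO is only a pseudo-norm, a function of \<open>x\<close> alone has norm zero, which
  neutralizes \<open>C(\<theta>)\<close> whatever its size. Take \<open>p = \<infinity>\<close> and \<open>F(x,y) = sin x\<close>, so that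
  \<open>F \<circ> \<phi>\<^sup>\<theta>\<close> is the plane wave \<open>sin (x cos \<theta> - y sin \<theta>)\<close>. Along the angles with
  \<open>sin \<theta> = 2\<pi> / 2\<^sup>k\<close> the wave makes exactly one oscillation in \<open>y\<close> over the dyadic interval
  \<open>[0, 2\<^sup>k)\<close>, and its Haar coefficient on \<open>[0,1) \<times> [0, 2\<^sup>k)\<close> keeps the BMO norm bounded away from
  zero as \<open>\<theta> \<rightarrow> 0\<close>, whereas \<open>\<epsilon>(\<theta>,p) \<parallel>F\<parallel>\<close> tends to zero. The finiteness of the Sobolev norm, which is
  defined through an arbitrary choice of weak derivatives, rests on their uniqueness.\<close>

section \<open>Smooth cut-offs\<close>

text \<open>The classical function exp(-1/u), extended by 0 to u <= 0. The extra denominator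
  \<open>u ^ m\<close> is carried along because differentiation stays inside the span of this
  family, which turns smoothness into an induction.\<close>

definition flat :: "nat \<Rightarrow> real \<Rightarrow> real" where
  "flat m u = (if u > 0 then exp (- (1 / u)) / u ^ m else 0)"

text \<open>From the right, the substitution v = 1/u gives v^m / exp v as v tends to infinity, and
  the exponential wins; from the left the function is identically 0.\<close>

lemma flat_tendsto_0: "(flat m \<longlongrightarrow> 0) (at 0)"
proof (rule filterlim_split_at)
  show "(flat m \<longlongrightarrow> 0) (at_left 0)"
    by (rule tendsto_eventually) (auto simp: flat_def eventually_at_filter)
  have "((\<lambda>u. inverse u ^ m / exp (inverse u)) \<longlongrightarrow> 0) (at_right (0::real))"
    by (rule filterlim_compose[OF tendsto_power_div_exp_0 filterlim_inverse_at_top_right])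
  moreover have "eventually (\<lambda>u. inverse u ^ m / exp (inverse u) = flat m u) (at_right 0)"
    by (auto simp: eventually_at_filter flat_def exp_minus field_simps)
  ultimately show "(flat m \<longlongrightarrow> 0) (at_right 0)"
    by (rule Lim_transform_eventually)
qed

lemma flat_has_derivative:
  "(flat m has_real_derivative flat (m + 2) u - real m * flat (m + 1) u) (at u)"
proof (cases u "0 :: real" rule: linorder_cases)
  case less
  have "((\<lambda>_. 0) has_real_derivative 0) (at u)"
    by simp
  then have "(flat m has_real_derivative 0) (at u)"
    by (rule has_field_derivative_transform_within_open[where S="{..<0}"])
       (use less in \<open>auto simp: flat_def\<close>)
  with less show ?thesis
    by (simp add: flat_def)
next
  case equal
  \<comment> \<open>The difference quotient at 0 is \<open>flat (Suc m) h\<close>, so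
    \<open>flat_tendsto_0\<close> already contains differentiability at the gluing point.\<close>
  have "((\<lambda>h. flat m h / h) \<longlongrightarrow> 0) (at 0)"
    by (rule Lim_transform_eventually[OF flat_tendsto_0[of "Suc m"]])
       (auto simp: flat_def eventually_at_filter)
  with equal show ?thesis
    by (simp add: has_field_derivative_iff flat_def)
next
  case greater
  have "((\<lambda>u. exp (- (1 / u)) / u ^ m) has_real_derivative
           (exp (- (1 / u)) * (1 / u\<^sup>2) * u ^ m - exp (- (1 / u)) * (real m * u ^ (m - 1))) / (u ^ m * u ^ m)) (at u)"
    using greater by (auto intro!: derivative_eq_intros simp: power2_eq_square)
  also have "(exp (- (1 / u)) * (1 / u\<^sup>2) * u ^ m - exp (- (1 / u)) * (real m * u ^ (m - 1))) / (u ^ m * u ^ m)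
      = flat (m + 2) u - real m * flat (m + 1) u"
    \<comment> \<open>The case m = 0 is split off because of the truncated subtraction in
      \<open>u ^ (m - 1)\<close>; there the coefficient \<open>real m\<close> vanishes.\<close>
    using greater by (cases m) (auto simp: flat_def field_simps power2_eq_square)
  finally have "((\<lambda>u. exp (- (1 / u)) / u ^ m) has_real_derivative
      flat (m + 2) u - real m * flat (m + 1) u) (at u)" .
  then show ?thesis
    by (rule has_field_derivative_transform_within_open[where S="{0<..}"])
       (use greater in \<open>auto simp: flat_def\<close>)
qed

section \<open>Closure properties of the classes \<open>Ck k\<close>\<close>

lemma Ck_SucD: "Ck (Suc k) f \<Longrightarrow> Ck k f"
proof (induction k arbitrary: f)
  case 0
  then show ?case
    by (auto intro!: has_derivative_continuous simp: continuous_on_eq_continuous_at)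
next
  case (Suc k)
  then obtain fx fy where "\<And>z. (f has_derivative (\<lambda>h. fst h * fx z + snd h * fy z)) (at z)"
    "Ck (Suc k) fx" "Ck (Suc k) fy"
    unfolding Ck.simps(2)[of "Suc k"] by blast
  then show ?case
    using Suc.IH unfolding Ck.simps(2) by blast
qed

lemma Ck_add: "Ck k f \<Longrightarrow> Ck k g \<Longrightarrow> Ck k (\<lambda>z. f z + g z)"
proof (induction k arbitrary: f g)
  case 0
  then show ?case
    by (auto intro: continuous_intros)
next
  case (Suc k)
  then obtain fx fy gx gy where
    "\<And>z. (f has_derivative (\<lambda>h. fst h * fx z + snd h * fy z)) (at z)" "Ck k fx" "Ck k fy"
    "\<And>z. (g has_derivative (\<lambda>h. fst h * gx z + snd h * gy z)) (at z)" "Ck k gx" "Ck k gy"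
    by auto
  then show ?case
    unfolding Ck.simps
    by (intro exI[of _ "\<lambda>z. fx z + gx z"] exI[of _ "\<lambda>z. fy z + gy z"])
       (auto intro!: derivative_eq_intros Suc.IH simp: algebra_simps)
qed

lemma Ck_mult: "Ck k f \<Longrightarrow> Ck k g \<Longrightarrow> Ck k (\<lambda>z. f z * g z)"
proof (induction k arbitrary: f g)
  case 0
  then show ?case
    by (auto intro: continuous_intros)
next
  case (Suc k)
  \<comment> \<open>Each summand of the product rule keeps one factor undifferentiated, so the
    factors themselves are required at order k before the induction hypothesis applies.\<close>
  have "Ck k f" "Ck k g"
    using Suc.prems by (auto dest: Ck_SucD simp del: Ck.simps)
  moreover obtain fx fy gx gy where
    "\<And>z. (f has_derivative (\<lambda>h. fst h * fx z + snd h * fy z)) (at z)" "Ck k fx" "Ck k fy"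
    "\<And>z. (g has_derivative (\<lambda>h. fst h * gx z + snd h * gy z)) (at z)" "Ck k gx" "Ck k gy"
    using Suc.prems by auto
  ultimately show ?case
    unfolding Ck.simps
    by (intro exI[of _ "\<lambda>z. fx z * g z + f z * gx z"] exI[of _ "\<lambda>z. fy z * g z + f z * gy z"])
       (auto intro!: derivative_eq_intros Suc.IH Ck_add simp: algebra_simps)
qed

lemma Ck_const: "Ck k (\<lambda>z. c)"
  by (induction k arbitrary: c) (auto intro!: exI[of _ "\<lambda>z. 0"])

text \<open>An affine argument covers all four factors of the cut-off at once. The induction keeps m
  arbitrary because the derivative involves the exponents m + 1 and m + 2.\<close>

lemma Ck_flat: "Ck k (\<lambda>z. flat m (a * fst z + b * snd z + c))"
proof (induction k arbitrary: m)
  case 0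
  have "continuous_on UNIV (flat m)"
    using flat_has_derivative by (meson DERIV_isCont continuous_at_imp_continuous_on)
  then show ?case
    by (auto intro!: continuous_intros continuous_on_compose2[of UNIV "flat m"])
next
  case (Suc k)
  define D where "D z = flat (m + 2) (a * fst z + b * snd z + c)
                        + (- real m) * flat (m + 1) (a * fst z + b * snd z + c)" for z
  have "Ck k D"
    unfolding D_def by (intro Ck_add Ck_mult Ck_const Suc)
  moreover have "((\<lambda>z. flat m (a * fst z + b * snd z + c)) has_derivative
                    (\<lambda>h. fst h * (a * D z) + snd h * (b * D z))) (at z)" for z
  proof -
    have "((\<lambda>z. a * fst z + b * snd z + c) has_derivative (\<lambda>h. a * fst h + b * snd h)) (at z)"
      by (auto intro!: derivative_eq_intros)
    from has_derivative_compose[OF this flat_has_derivative[THEN has_field_derivative_imp_has_derivative]]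
    show ?thesis
      by (rule has_derivative_eq_rhs) (auto simp: D_def algebra_simps)
  qed
  ultimately show ?case
    unfolding Ck.simps
    by (intro exI[of _ "\<lambda>z. a * D z"] exI[of _ "\<lambda>z. b * D z"] conjI allI Ck_mult Ck_const)
qed

text \<open>For n > 0 each factor is positive exactly on one side of one edge, so the product is
  positive exactly on the open box. A factor equals exp(-1/(n t)) at distance t inside its edge, so
  growing n pushes the product up to the indicator of the box.\<close>

definition cutoff :: "real \<times> real \<Rightarrow> real \<times> real \<Rightarrow> nat \<Rightarrow> real \<times> real \<Rightarrow> real" where
  "cutoff l u n z =
     flat 0 (real n * (fst z - fst l)) * flat 0 (real n * (fst u - fst z)) *
     (flat 0 (real n * (snd z - snd l)) * flat 0 (real n * (snd u - snd z)))"

lemma flat_0_bounds: "0 \<le> flat 0 x" "flat 0 x \<le> 1"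
  by (auto simp: flat_def)

lemma cutoff_bounds: "0 \<le> cutoff l u n z" "cutoff l u n z \<le> 1"
  unfolding cutoff_def by (intro mult_nonneg_nonneg mult_le_one flat_0_bounds)+

lemma cutoff_eq_0: "z \<notin> box l u \<Longrightarrow> cutoff l u n z = 0"
  by (cases z; cases l; cases u) (auto simp: cutoff_def flat_def mem_box Basis_prod_def zero_less_mult_iff)

lemma cutoff_tendsto: "(\<lambda>n. cutoff l u n z) \<longlonglongrightarrow> indicator (box l u) z"
proof (cases "z \<in> box l u")
  case True
  have *: "(\<lambda>n. flat 0 (real n * t)) \<longlonglongrightarrow> 1" if "t > 0" for t
  proof -
    have "(\<lambda>n. exp (- (1 / t * (1 / real n)))) \<longlonglongrightarrow> exp (- (1 / t * 0))"
      by (intro tendsto_intros lim_1_over_n)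
    moreover have "eventually (\<lambda>n. exp (- (1 / t * (1 / real n))) = flat 0 (real n * t)) sequentially"
      using eventually_gt_at_top[of 0] by eventually_elim (use that in \<open>auto simp: flat_def field_simps\<close>)
    ultimately show ?thesis
      by (simp add: Lim_transform_eventually)
  qed
  have "(\<lambda>n. cutoff l u n z) \<longlonglongrightarrow> 1 * 1 * (1 * 1)"
    unfolding cutoff_def
    by (intro tendsto_mult *)
       (use True in \<open>cases z; cases l; cases u; auto simp: mem_box Basis_prod_def\<close>)+
  then show ?thesis
    using True by simp
qed (simp add: cutoff_eq_0)

lemma test_function_cutoff: "test_function (cutoff l u n)"
proof -
  have *: "Ck k (\<lambda>z. flat 0 (real n * (fst z - fst l)))"
    "Ck k (\<lambda>z. flat 0 (real n * (fst u - fst z)))"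
    "Ck k (\<lambda>z. flat 0 (real n * (snd z - snd l)))"
    "Ck k (\<lambda>z. flat 0 (real n * (snd u - snd z)))" for k
    using Ck_flat[of k 0 "real n" 0 "- real n * fst l"] Ck_flat[of k 0 "- real n" 0 "real n * fst u"]
      Ck_flat[of k 0 0 "real n" "- real n * snd l"] Ck_flat[of k 0 0 "- real n" "real n * snd u"]
    by (simp_all add: algebra_simps)
  have "{z. cutoff l u n z \<noteq> 0} \<subseteq> cbox l u"
    using cutoff_eq_0 box_subset_cbox by blast
  then have "compact (closure {z. cutoff l u n z \<noteq> 0})"
    by (meson bounded_cbox bounded_subset compact_closure)
  with * show ?thesis
    unfolding test_function_def cutoff_def by (auto intro!: Ck_mult)
qed

section \<open>Weak derivatives\<close>

text \<open>The cut-off is at most 1 and lives in a compact box, on which G is integrable, so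
  domination applies.\<close>

lemma integrable_mult_cutoff:
  assumes "G \<in> L1_loc"
  shows "integrable lebesgue (\<lambda>z. G z * cutoff l u n z)"
proof (rule Bochner_Integration.integrable_bound)
  show "integrable lebesgue (\<lambda>z. indicator (cbox l u) z *\<^sub>R G z)"
    using assms by (auto simp: L1_loc_def set_integrable_def)
  have "continuous_on UNIV (cutoff l u n)"
    using test_function_cutoff by (metis Ck.simps(1) test_function_def)
  then have "cutoff l u n \<in> borel_measurable lebesgue"
    by (intro measurable_completion) (simp add: borel_measurable_continuous_onI)
  then show "(\<lambda>z. G z * cutoff l u n z) \<in> borel_measurable lebesgue"
    using assms by (auto simp: L1_loc_def)
  have "norm (G z * cutoff l u n z) \<le> norm (indicator (cbox l u) z *\<^sub>R G z)" for z
    using cutoff_bounds[of l u n z] cutoff_eq_0[of z l u n] box_subset_cbox[of l u]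
    by (cases "z \<in> box l u") (auto simp: abs_mult mult_left_le indicator_def)
  then show "AE z in lebesgue. norm (G z * cutoff l u n z) \<le> norm (indicator (cbox l u) z *\<^sub>R G z)"
    by simp
qed

text \<open>Lebesgue differentiation: off a null set, f x is the limit of averages over cubes with
  corner x, and all these averages are 0.\<close>

lemma AE_eq_0_if_box_integrals_eq_0:
  fixes f :: "'a::euclidean_space \<Rightarrow> real"
  assumes "\<And>a b. f integrable_on cbox a b" and "\<And>a b. integral (cbox a b) f = 0"
  shows "AE x in lebesgue. f x = 0"
proof -
  obtain N where N: "negligible N" and
    lim: "\<And>x e. \<lbrakk>x \<notin> N; 0 < e\<rbrakk> \<Longrightarrow> \<exists>d>0. \<forall>h. 0 < h \<and> h < d \<longrightarrow>
        norm (integral (cbox x (x + h *\<^sub>R One)) f /\<^sub>R h ^ DIM('a) - f x) < e"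
    using integrable_ccontinuous_explicit[OF assms(1)] by metis
  have "f x = 0" if x: "x \<notin> N" for x
  proof (rule ccontr)
    assume "f x \<noteq> 0"
    then obtain d where d: "d > 0" "\<And>h. 0 < h \<and> h < d \<Longrightarrow>
        norm (integral (cbox x (x + h *\<^sub>R One)) f /\<^sub>R h ^ DIM('a) - f x) < norm (f x)"
      using lim[OF x, of "norm (f x)"] by auto
    show False
      using d(2)[of "d / 2"] d(1) unfolding assms(2) by simp
  qed
  moreover have "AE x in lebesgue. x \<notin> N"
    using N by (simp add: AE_not_in negligible_iff_null_sets)
  ultimately show ?thesis
    by (auto elim!: eventually_mono)
qed

text \<open>The difference H integrates to 0 against every cut-off. Letting the cut-offs increase to
  box indicators gives vanishing integrals over all boxes, hence H = 0 almost everywhere.\<close>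

lemma has_weak_partial_unique:
  assumes "has_weak_partial F e G" and "has_weak_partial F e G'"
  shows "AE z in lebesgue. G z = G' z"
proof -
  define H where "H z = G z - G' z" for z
  have G: "G \<in> L1_loc" "G' \<in> L1_loc"
    using assms by (auto simp: has_weak_partial_def)
  have H_meas: "H \<in> borel_measurable lebesgue"
    unfolding H_def[abs_def] using G by (intro borel_measurable_diff) (auto simp: L1_loc_def)
  have H_int: "set_integrable lebesgue (cbox l u) H" for l u
    unfolding H_def using G by (intro set_integral_diff) (auto simp: L1_loc_def)
  have H_cutoff: "integrable lebesgue (\<lambda>z. H z * cutoff l u n z)" for l u n
    unfolding H_def left_diff_distrib by (intro Bochner_Integration.integrable_diff integrable_mult_cutoff G)
  have H_0: "(LINT z|lebesgue. H z * cutoff l u n z) = 0" for l u n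
  proof -
    have "(LINT z|lebesgue. G z * cutoff l u n z) = (LINT z|lebesgue. G' z * cutoff l u n z)"
      using assms test_function_cutoff[of l u n] by (auto simp: has_weak_partial_def)
    then show ?thesis
      using integrable_mult_cutoff[OF G(1), of l u n] integrable_mult_cutoff[OF G(2), of l u n]
      by (simp add: H_def left_diff_distrib)
  qed
  have "integral (cbox l u) H = 0" for l u
  proof -
    \<comment> \<open>Dominated convergence, with \<bar>H\<bar> restricted to the closed box as
      majorant.\<close>
    have "(\<lambda>n. LINT z|lebesgue. H z * cutoff l u n z) \<longlonglongrightarrow> (LINT z|lebesgue. H z * indicator (box l u) z)"
    proof (rule integral_dominated_convergence[where w="\<lambda>z. norm (indicator (cbox l u) z *\<^sub>R H z)"])
      show "(\<lambda>z. H z * indicator (box l u) z) \<in> borel_measurable lebesgue"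
        using H_meas by (intro borel_measurable_times borel_measurable_indicator) auto
      show "(\<lambda>z. H z * cutoff l u n z) \<in> borel_measurable lebesgue" for n
        by (rule borel_measurable_integrable[OF H_cutoff])
      show "integrable lebesgue (\<lambda>z. norm (indicator (cbox l u) z *\<^sub>R H z))"
        using H_int[of l u] unfolding set_integrable_def by (rule integrable_norm)
      show "AE z in lebesgue. (\<lambda>n. H z * cutoff l u n z) \<longlonglongrightarrow> H z * indicator (box l u) z"
        by (intro always_eventually allI tendsto_intros cutoff_tendsto)
      have "norm (H z * cutoff l u n z) \<le> norm (indicator (cbox l u) z *\<^sub>R H z)" for z n
        using cutoff_bounds[of l u n z] cutoff_eq_0[of z l u n] box_subset_cbox[of l u]
        by (cases "z \<in> box l u") (auto simp: abs_mult mult_left_le indicator_def)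
      then show "AE z in lebesgue. norm (H z * cutoff l u n z) \<le> norm (indicator (cbox l u) z *\<^sub>R H z)" for n
        by simp
    qed
    then have "(LINT z|lebesgue. H z * indicator (box l u) z) = 0"
      unfolding H_0 by (simp only: LIMSEQ_const_iff)
    then have "(LINT z:box l u|lebesgue. H z) = 0"
      by (simp add: set_lebesgue_integral_def mult.commute)
    moreover have "set_integrable lebesgue (box l u) H"
      by (rule set_integrable_subset[OF H_int[of l u]]) (auto simp: box_subset_cbox)
    \<comment> \<open>The limit produced the open box; its boundary is null, so the closed box has
      the same integral.\<close>
    ultimately show ?thesis
      using set_lebesgue_integral_eq_integral(2)[of "box l u" H] integral_open_interval[of l u H] by simp
  qed
  then have "AE z in lebesgue. H z = 0"
    using H_int set_lebesgue_integral_eq_integral(1) by (intro AE_eq_0_if_box_integrals_eq_0) blast+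
  then show ?thesis
    by (auto simp: H_def elim: eventually_mono)
qed

section \<open>Local integrability of continuous functions\<close>

lemma continuous_imp_measurable_lebesgue:
  fixes f :: "'a::euclidean_space \<Rightarrow> real"
  assumes "continuous_on UNIV f"
  shows "f \<in> borel_measurable lebesgue"
  using assms by (intro measurable_completion) (simp add: borel_measurable_continuous_onI)

lemma continuous_imp_set_integrable_lebesgue:
  fixes f :: "'a::euclidean_space \<Rightarrow> real"
  assumes "continuous_on UNIV f" and "compact K"
  shows "set_integrable lebesgue K f"
proof -
  have "integrable lborel (\<lambda>x. indicator K x *\<^sub>R f x)"
    using assms by (intro borel_integrable_compact) (auto intro: continuous_on_subset)
  then show ?thesis
    unfolding set_integrable_def by (subst integrable_completion) auto
qed

lemma continuous_imp_L1_loc: "continuous_on UNIV F \<Longrightarrow> F \<in> L1_loc"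
  by (auto simp: L1_loc_def continuous_imp_measurable_lebesgue continuous_imp_set_integrable_lebesgue)

lemma continuous_imp_L2_loc: "continuous_on UNIV F \<Longrightarrow> F \<in> L2_loc"
  by (auto simp: L2_loc_def continuous_imp_measurable_lebesgue
      intro!: continuous_imp_set_integrable_lebesgue continuous_intros)

section \<open>Integration by parts: classical derivatives are weak derivatives\<close>

lemma integral_deriv_compact_support:
  fixes f g :: "real \<Rightarrow> real"
  assumes deriv: "\<And>x. (f has_real_derivative g x) (at x)" and cont: "continuous_on UNIV g"
    and f0: "\<And>x. \<bar>x\<bar> \<ge> M \<Longrightarrow> f x = 0" and g0: "\<And>x. \<bar>x\<bar> \<ge> M \<Longrightarrow> g x = 0"
  shows "(LINT x|lborel. g x) = 0"
proof -
  \<comment> \<open>No sign of M is assumed; with \<bar>M\<bar> the endpoints are in the right order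
    for the fundamental theorem, and f still vanishes at both of them.\<close>
  have "g x = g x * indicator {- \<bar>M\<bar> .. \<bar>M\<bar>} x" for x
    using g0[of x] by (cases "\<bar>x\<bar> \<ge> M") (auto simp: indicator_def)
  then have "(LINT x|lborel. g x) = (LINT x|lborel. g x * indicator {- \<bar>M\<bar> .. \<bar>M\<bar>} x)"
    by (rule Bochner_Integration.integral_cong[OF refl])
  also have "\<dots> = f \<bar>M\<bar> - f (- \<bar>M\<bar>)"
    by (rule integral_FTC_Icc_real) (use deriv cont in \<open>auto simp: continuous_on_eq_continuous_at\<close>)
  finally show ?thesis
    by (simp add: f0)
qed

text \<open>Off the closed set K the function is 0 on a whole neighbourhood, so uniqueness of the
  derivative forces both partials to vanish there.\<close>

lemma partial_eq_0_outside_support: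
  fixes u ux uy :: "real \<times> real \<Rightarrow> real"
  assumes deriv: "\<And>z. (u has_derivative (\<lambda>h. fst h * ux z + snd h * uy z)) (at z)"
    and supp: "closed K" "\<And>z. z \<notin> K \<Longrightarrow> u z = 0" and "z \<notin> K"
  shows "ux z = 0" "uy z = 0"
proof -
  have "(u has_derivative (\<lambda>h. 0)) (at z)"
    by (rule has_derivative_transform_within_open[where s="- K", OF has_derivative_const[of 0]])
       (use assms in \<open>auto simp: open_Compl\<close>)
  then have "(\<lambda>h. fst h * ux z + snd h * uy z) = (\<lambda>h. 0)"
    using deriv has_derivative_unique by blast
  from fun_cong[OF this, of "(1, 0)"] fun_cong[OF this, of "(0, 1)"]
  show "ux z = 0" "uy z = 0"
    by auto
qed

lemma integrable_continuous_compact_support: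
  fixes f :: "'a::euclidean_space \<Rightarrow> real"
  assumes "continuous_on UNIV f" "compact K" "\<And>z. z \<notin> K \<Longrightarrow> f z = 0"
  shows "integrable lborel f"
proof -
  have int: "integrable lborel (\<lambda>z. indicator K z *\<^sub>R f z)"
    using assms by (intro borel_integrable_compact) (auto intro: continuous_on_subset)
  have eq: "indicator K z *\<^sub>R f z = f z" for z
    using assms(3) by (cases "z \<in> K") auto
  show ?thesis
    using int unfolding eq .
qed

text \<open>By Fubini one may integrate first in the variable of differentiation, where the
  one-dimensional fundamental theorem gives 0 on every line.\<close>

lemma integral_partial_compact_support:
  fixes u ux uy :: "real \<times> real \<Rightarrow> real"
  assumes deriv: "\<And>z. (u has_derivative (\<lambda>h. fst h * ux z + snd h * uy z)) (at z)"
    and cont: "continuous_on UNIV ux" "continuous_on UNIV uy"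
    and supp: "compact K" "\<And>z. z \<notin> K \<Longrightarrow> u z = 0"
  shows "integrable lborel ux" "integrable lborel uy"
    and "(LINT z|lborel. ux z) = 0" "(LINT z|lborel. uy z) = 0"
proof -
  note zero = partial_eq_0_outside_support[OF deriv compact_imp_closed[OF supp(1)] supp(2)]
  show int: "integrable lborel ux" "integrable lborel uy"
    using zero by (auto intro: integrable_continuous_compact_support[OF cont(1) supp(1)]
        integrable_continuous_compact_support[OF cont(2) supp(1)])
  obtain M where M: "\<And>z. z \<in> K \<Longrightarrow> norm z < M"
    using supp(1) compact_imp_bounded bounded_pos_less by metis
  have out: "(x, y) \<notin> K" if "\<bar>x\<bar> \<ge> M \<or> \<bar>y\<bar> \<ge> M" for x y
    using M[of "(x, y)"] norm_fst_le[of x y] norm_snd_le[of y x] that by fastforce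
  have dx: "((\<lambda>x. u (x, y)) has_real_derivative ux (x, y)) (at x)"
    and dy: "((\<lambda>y. u (x, y)) has_real_derivative uy (x, y)) (at y)" for x y
  proof -
    have "((\<lambda>x. (x, y)) has_derivative (\<lambda>h. (h, 0))) (at x)"
      by (auto intro!: derivative_eq_intros)
    from has_derivative_compose[OF this deriv]
    show "((\<lambda>x. u (x, y)) has_real_derivative ux (x, y)) (at x)"
      by (simp add: has_field_derivative_def mult.commute[of _ "ux (x, y)"])
    have "((\<lambda>y. (x, y)) has_derivative (\<lambda>h. (0, h))) (at y)"
      by (auto intro!: derivative_eq_intros)
    from has_derivative_compose[OF this deriv]
    show "((\<lambda>y. u (x, y)) has_real_derivative uy (x, y)) (at y)"
      by (simp add: has_field_derivative_def mult.commute[of _ "uy (x, y)"])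
  qed
  have ix: "(LINT x|lborel. ux (x, y)) = 0" for y
    by (rule integral_deriv_compact_support[OF dx, where M=M])
       (auto intro!: continuous_on_compose2[OF cont(1)] continuous_intros zero supp out)
  have iy: "(LINT y|lborel. uy (x, y)) = 0" for x
    by (rule integral_deriv_compact_support[OF dy, where M=M])
       (auto intro!: continuous_on_compose2[OF cont(2)] continuous_intros zero supp out)
  have "(LINT y|lborel. LINT x|lborel. ux (x, y)) = (LINT z|lborel. ux z)"
    using lborel_pair.integral_snd[of "\<lambda>x y. ux (x, y)"] int by (simp add: lborel_prod)
  then show "(LINT z|lborel. ux z) = 0"
    by (simp add: ix)
  have "(LINT x|lborel. LINT y|lborel. uy (x, y)) = (LINT z|lborel. uy z)"
    using lborel_pair.integral_fst[of "\<lambda>x y. uy (x, y)"] int by (simp add: lborel_prod)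
  then show "(LINT z|lborel. uy z) = 0"
    by (simp add: iy)
qed

text \<open>The product of F with a test function is C^1 with compact support, so its partials
  integrate to 0; splitting them by the product rule is integration by parts.\<close>

lemma has_weak_partial_C1:
  fixes F Fx Fy :: "real \<times> real \<Rightarrow> real"
  assumes deriv: "\<And>z. (F has_derivative (\<lambda>h. fst h * Fx z + snd h * Fy z)) (at z)"
    and cont: "continuous_on UNIV Fx" "continuous_on UNIV Fy"
  shows "has_weak_partial F (1, 0) Fx" "has_weak_partial F (0, 1) Fy"
proof -
  have cF: "continuous_on UNIV F"
    using deriv by (meson has_derivative_continuous continuous_at_imp_continuous_on)
  have parts: "(LINT z|lebesgue. F z * frechet_derivative \<psi> (at z) (1, 0)) = - (LINT z|lebesgue. Fx z * \<psi> z)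
    \<and> (LINT z|lebesgue. F z * frechet_derivative \<psi> (at z) (0, 1)) = - (LINT z|lebesgue. Fy z * \<psi> z)"
    if "test_function \<psi>" for \<psi>
  proof -
    define K where "K = closure {z. \<psi> z \<noteq> 0}"
    have K: "compact K" "\<And>z. z \<notin> K \<Longrightarrow> \<psi> z = 0"
      using that closure_subset[of "{z. \<psi> z \<noteq> 0}"] by (auto simp: K_def test_function_def)
    have "Ck (Suc 0) \<psi>"
      using that by (simp add: test_function_def del: Ck.simps)
    then obtain px py where
      d\<psi>: "\<And>z. (\<psi> has_derivative (\<lambda>h. fst h * px z + snd h * py z)) (at z)"
      and cp: "continuous_on UNIV px" "continuous_on UNIV py"
      by auto
    have c\<psi>: "continuous_on UNIV \<psi>"
      using d\<psi> by (meson has_derivative_continuous continuous_at_imp_continuous_on)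
    have fd: "frechet_derivative \<psi> (at z) = (\<lambda>h. fst h * px z + snd h * py z)" for z
      by (rule frechet_derivative_at[OF d\<psi>, symmetric])
    have d: "((\<lambda>z. F z * \<psi> z) has_derivative
        (\<lambda>h. fst h * (F z * px z + Fx z * \<psi> z) + snd h * (F z * py z + Fy z * \<psi> z))) (at z)" for z
      by (rule has_derivative_eq_rhs[OF has_derivative_mult[OF deriv d\<psi>]]) (auto simp: algebra_simps)
    have c: "continuous_on UNIV (\<lambda>z. F z * px z + Fx z * \<psi> z)" "continuous_on UNIV (\<lambda>z. F z * py z + Fy z * \<psi> z)"
      by (intro continuous_intros cF cont c\<psi> cp)+
    have "F z * \<psi> z = 0" if "z \<notin> K" for z
      using K(2)[OF that] by simp
    note sum_0 = integral_partial_compact_support(3,4)[OF d c K(1) this]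
    note p_0 = partial_eq_0_outside_support[OF d\<psi> compact_imp_closed[OF K(1)] K(2)]
    have int: "integrable lborel (\<lambda>z. F z * px z)" "integrable lborel (\<lambda>z. F z * py z)"
      "integrable lborel (\<lambda>z. Fx z * \<psi> z)" "integrable lborel (\<lambda>z. Fy z * \<psi> z)"
      by (rule integrable_continuous_compact_support[OF _ K(1)],
          intro continuous_intros cF cont c\<psi> cp, simp add: K p_0)+
    have "(LINT z|lborel. F z * px z) = - (LINT z|lborel. Fx z * \<psi> z)"
      "(LINT z|lborel. F z * py z) = - (LINT z|lborel. Fy z * \<psi> z)"
      using sum_0 int by (simp_all add: eq_neg_iff_add_eq_0)
    \<comment> \<open>Weak derivatives are stated over Lebesgue measure, Fubini over
      \<open>lborel\<close>. The integrands are continuous, hence Borel, so both integrals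
      agree.\<close>
    moreover have leb: "(LINT z|lebesgue. v z * w z) = (LINT z|lborel. v z * w z)"
      if "continuous_on UNIV v" "continuous_on UNIV w" for v w :: "real \<times> real \<Rightarrow> real"
    proof (rule integral_completion)
      have "continuous_on UNIV (\<lambda>z. v z * w z)"
        using that by (rule continuous_on_mult)
      then show "(\<lambda>z. v z * w z) \<in> borel_measurable lborel"
        by (simp add: borel_measurable_continuous_onI)
    qed
    ultimately show ?thesis
      using leb[OF cF cp(1)] leb[OF cF cp(2)] leb[OF cont(1) c\<psi>] leb[OF cont(2) c\<psi>] by (simp add: fd)
  qed
  show "has_weak_partial F (1, 0) Fx" "has_weak_partial F (0, 1) Fy"
    using parts by (simp_all add: has_weak_partial_def continuous_imp_L1_loc cF cont)
qed

section \<open>Sobolev norms for the exponent \<infinity>\<close>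

lemma Lp_norm_infinity_le:
  assumes "F \<in> borel_measurable lebesgue" and "AE z in lebesgue. \<bar>F z\<bar> \<le> B"
  shows "Lp_norm \<infinity> F \<le> ennreal B"
proof -
  have "esssup lebesgue (\<lambda>z. ennreal \<bar>F z\<bar>) \<le> ennreal B"
    using assms by (intro esssup_I) (auto elim!: eventually_mono intro: ennreal_leI)
  then show ?thesis
    by (simp add: Lp_norm_def)
qed

text \<open>The derivative picked by \<open>SOME\<close> is not known explicitly, but it agrees
  almost everywhere with G, so a bound on G passes to it.\<close>

lemma Lp_norm_infinity_weak_partial_le:
  assumes "has_weak_partial F e G" and "AE z in lebesgue. \<bar>G z\<bar> \<le> B"
  shows "Lp_norm \<infinity> (weak_partial e F) \<le> ennreal B"
proof (rule Lp_norm_infinity_le)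
  have weak: "has_weak_partial F e (weak_partial e F)"
    unfolding weak_partial_def using assms(1) by (rule someI[of "has_weak_partial F e"])
  then show "weak_partial e F \<in> borel_measurable lebesgue"
    by (auto simp: has_weak_partial_def L1_loc_def)
  show "AE z in lebesgue. \<bar>weak_partial e F z\<bar> \<le> B"
    using has_weak_partial_unique[OF weak assms(1)] assms(2) by eventually_elim simp
qed

text \<open>For the exponent \<infinity> boundedness is enough and no decay is asked for, so a
  function periodic in x and constant in y can qualify.\<close>

lemma W1p_infinity_C1:
  fixes F Fx Fy :: "real \<times> real \<Rightarrow> real"
  assumes deriv: "\<And>z. (F has_derivative (\<lambda>h. fst h * Fx z + snd h * Fy z)) (at z)"
    and cont: "continuous_on UNIV Fx" "continuous_on UNIV Fy"
    and bound: "\<And>z. \<bar>F z\<bar> \<le> B" "\<And>z. \<bar>Fx z\<bar> \<le> B" "\<And>z. \<bar>Fy z\<bar> \<le> B"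
  shows "F \<in> W1p \<infinity>" "W1p_norm \<infinity> F < \<infinity>"
proof -
  have cF: "continuous_on UNIV F"
    using deriv by (meson has_derivative_continuous continuous_at_imp_continuous_on)
  have Lp: "f \<in> Lp \<infinity>" if "continuous_on UNIV f" "\<And>z. \<bar>f z\<bar> \<le> B" for f
    unfolding Lp_def mem_Collect_eq infinity_ennreal_def[symmetric]
    using that le_less_trans[OF Lp_norm_infinity_le[of f B] ennreal_less_top]
    by (simp add: continuous_imp_measurable_lebesgue)
  note weak = has_weak_partial_C1[OF deriv cont]
  show "F \<in> W1p \<infinity>"
    unfolding W1p_def using weak Lp[OF cF bound(1)] Lp[OF cont(1) bound(2)] Lp[OF cont(2) bound(3)] by blast
  have "Lp_norm \<infinity> (weak_partial (1, 0) F) \<le> ennreal B" "Lp_norm \<infinity> (weak_partial (0, 1) F) \<le> ennreal B"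
    by (rule Lp_norm_infinity_weak_partial_le[OF weak(1)], simp add: bound)
       (rule Lp_norm_infinity_weak_partial_le[OF weak(2)], simp add: bound)
  moreover have "Lp_norm \<infinity> F \<le> ennreal B"
    using bound by (intro Lp_norm_infinity_le continuous_imp_measurable_lebesgue cF) auto
  ultimately have "W1p_norm \<infinity> F \<le> ennreal B + ennreal B + ennreal B"
    unfolding W1p_norm_def by (intro add_mono)
  also have "\<dots> < \<infinity>"
    by simp
  finally show "W1p_norm \<infinity> F < \<infinity>" .
qed

section \<open>Haar coefficients\<close>

text \<open>The integral over the left half minus that over the right half is a second difference of
  the antiderivative G.\<close>

lemma has_bochner_integral_haar:
  assumes "a < b" and deriv: "\<And>x. (G has_real_derivative g x) (at x)" and cont: "continuous_on UNIV g"
  shows "has_bochner_integral lborel (\<lambda>x. g x * haar (a, b) x)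
           ((2 * G ((a + b) / 2) - G a - G b) / sqrt (b - a))"
proof -
  let ?m = "(a + b) / 2"
  have int: "has_bochner_integral lborel (\<lambda>x. g x * indicator {c..d} x) (G d - G c)" if "c \<le> d" for c d
    using that deriv cont
    by (intro has_bochner_integral_FTC_Icc_real) (auto simp: continuous_on_eq_continuous_at)
  have "has_bochner_integral lborel
      (\<lambda>x. (g x * indicator {a..?m} x - g x * indicator {?m..b} x) / sqrt (b - a))
      (((G ?m - G a) - (G b - G ?m)) / sqrt (b - a))"
    using \<open>a < b\<close> by (intro has_bochner_integral_divide_zero has_bochner_integral_diff int) auto
  moreover have "g \<in> borel_measurable borel"
    using cont by (rule borel_measurable_continuous_onI)
  \<comment> \<open>The fundamental theorem speaks of closed intervals, the Haar function of
    half-open ones; they disagree at most at the midpoint and the right endpoint.\<close>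
  moreover have "AE x in lborel. (g x * indicator {a..?m} x - g x * indicator {?m..b} x) / sqrt (b - a)
      = g x * haar (a, b) x"
    using AE_lborel_singleton[of ?m] AE_lborel_singleton[of b]
    by eventually_elim (use \<open>a < b\<close> in \<open>auto simp: haar_def indicator_def\<close>)
  ultimately show ?thesis
    by (subst (asm) has_bochner_integral_cong_AE) (auto simp: haar_def algebra_simps)
qed

lemma has_bochner_integral_lborel_tensor:
  fixes f :: "'a::euclidean_space \<Rightarrow> real" and g :: "'b::euclidean_space \<Rightarrow> real"
  assumes "has_bochner_integral lborel f p" and "has_bochner_integral lborel g q"
  shows "has_bochner_integral lborel (\<lambda>z. f (fst z) * g (snd z)) (p * q)"
proof -
  have f: "integrable lborel f" "integral\<^sup>L lborel f = p"
    and g: "integrable lborel g" "integral\<^sup>L lborel g = q"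
    using assms by (auto simp: has_bochner_integral_iff)
  note [measurable] = borel_measurable_integrable[OF f(1)] borel_measurable_integrable[OF g(1)]
  have int: "integrable (lborel \<Otimes>\<^sub>M lborel) (\<lambda>z. f (fst z) * g (snd z))"
  proof (rule lborel_pair.Fubini_integrable)
    have "integrable lborel (\<lambda>x. \<bar>f x\<bar> * (LINT y|lborel. \<bar>g y\<bar>))"
      using f by (intro integrable_mult_left integrable_abs)
    then show "integrable lborel (\<lambda>x. LINT y|lborel. norm (f (fst (x, y)) * g (snd (x, y))))"
      by (simp add: abs_mult)
  qed (use f g in auto)
  show ?thesis
    using int lborel_pair.integral_fst'[OF int] f g by (simp add: has_bochner_integral_iff lborel_prod)
qed

text \<open>The value enters as a variable \<open>r\<close> with an equation, so that it can be
  instantiated with an already simplified closed form.\<close>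

lemma has_bochner_integral_haar_tensor:
  assumes "a < b" "\<And>x. (G has_real_derivative g x) (at x)" "continuous_on UNIV g"
    and "c < d" "\<And>x. (K has_real_derivative k x) (at x)" "continuous_on UNIV k"
    and r: "r = (2 * G ((a + b) / 2) - G a - G b) / sqrt (b - a) *
                ((2 * K ((c + d) / 2) - K c - K d) / sqrt (d - c))"
  shows "has_bochner_integral lebesgue
           (\<lambda>z. g (fst z) * k (snd z) * (haar (a, b) (fst z) * haar (c, d) (snd z))) r"
proof -
  have "has_bochner_integral lborel
          (\<lambda>z. (g (fst z) * haar (a, b) (fst z)) * (k (snd z) * haar (c, d) (snd z))) r"
    (is "has_bochner_integral _ ?f _")
    unfolding r by (intro has_bochner_integral_lborel_tensor has_bochner_integral_haar assms)
  then have "has_bochner_integral lebesgue ?f r"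
    by (auto simp: has_bochner_integral_iff integrable_completion integral_completion)
  then show ?thesis
    by (simp add: mult_ac)
qed

lemma dyadic_grid_less: "I \<in> dyadic_grid a \<Longrightarrow> fst I < snd I"
  by (auto simp: dyadic_grid_def dyadic_def split: if_splits)

text \<open>In y the integrand is the constant 1, whose antiderivative y has vanishing second
  difference: the Haar function in y has mean zero.\<close>

lemma haar_coeff_fst_eq_0:
  assumes "\<And>x. (G has_real_derivative g x) (at x)" "continuous_on UNIV g" "fst I < snd I" "fst J < snd J"
  shows "haar_coeff (\<lambda>z. g (fst z)) I J = 0"
proof -
  have "((\<lambda>x. x) has_real_derivative 1) (at x)" for x :: real
    by (rule DERIV_ident)
  from has_bochner_integral_haar_tensor[OF assms(3,1,2) assms(4) this _ refl]
  show ?thesis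
    by (auto simp: haar_coeff_def has_bochner_integral_iff field_simps)
qed

text \<open>The addition formula splits the wave into two tensor products. The choice of \<beta>
  fits exactly one period in y into the interval from 0 to L, so one product integrates to 0 and the
  other follows the sign pattern of the Haar function.\<close>

lemma haar_coeff_plane_wave:
  assumes "\<alpha> \<noteq> 0" "L > 0" and \<beta>: "\<beta> = 2 * pi / L"
  shows "haar_coeff (\<lambda>z. sin (\<alpha> * fst z - \<beta> * snd z)) (0, 1) (0, L)
           = - ((2 * sin (\<alpha> / 2) - sin \<alpha>) / \<alpha> * (2 * sqrt L / pi))"
proof -
  have "\<beta> \<noteq> 0" and \<beta>L: "\<beta> * L = 2 * pi"
    using assms by simp_all
  have sin_int: "((\<lambda>x. - cos (c * x) / c) has_real_derivative sin (c * x)) (at x)"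
    and cos_int: "((\<lambda>x. sin (c * x) / c) has_real_derivative cos (c * x)) (at x)"
    if "c \<noteq> 0" for c x :: real
    using that by (auto intro!: derivative_eq_intros)
  note tensor = has_bochner_integral_haar_tensor[of 0 1, OF _ _ _ \<open>L > 0\<close>]
  \<comment> \<open>The antiderivative sin(\<beta> y)/\<beta> vanishes at 0, L/2 and L.\<close>
  have sin_cos: "has_bochner_integral lebesgue
     (\<lambda>z. sin (\<alpha> * fst z) * cos (\<beta> * snd z) * (haar (0, 1) (fst z) * haar (0, L) (snd z))) 0"
    by (rule tensor[OF _ sin_int _ cos_int])
       (use assms \<open>\<beta> \<noteq> 0\<close> in \<open>auto intro!: continuous_intros\<close>)
  \<comment> \<open>Here the antiderivative -cos(\<beta> y)/\<beta> equals -1/\<beta>, 1/\<beta>,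
    -1/\<beta> at 0, L/2, L, with second difference 4/\<beta>.\<close>
  have cos_sin: "has_bochner_integral lebesgue
     (\<lambda>z. cos (\<alpha> * fst z) * sin (\<beta> * snd z) * (haar (0, 1) (fst z) * haar (0, L) (snd z)))
     ((2 * sin (\<alpha> / 2) - sin \<alpha>) / \<alpha> * (4 / (\<beta> * sqrt L)))"
    by (rule tensor[OF _ cos_int _ sin_int])
       (use assms(1,2) \<open>\<beta> \<noteq> 0\<close> \<beta>L in \<open>auto intro!: continuous_intros simp: field_simps\<close>)
  have scale: "4 / (\<beta> * sqrt L) = 2 * sqrt L / pi"
    using \<open>L > 0\<close> by (simp add: \<beta> field_simps)
  have "has_bochner_integral lebesgue
     (\<lambda>z. sin (\<alpha> * fst z - \<beta> * snd z) * (haar (0, 1) (fst z) * haar (0, L) (snd z)))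
     (0 - (2 * sin (\<alpha> / 2) - sin \<alpha>) / \<alpha> * (2 * sqrt L / pi))"
    unfolding sin_diff left_diff_distrib scale[symmetric]
    by (rule has_bochner_integral_diff[OF sin_cos cos_sin])
  then show ?thesis
    by (auto simp: haar_coeff_def has_bochner_integral_iff)
qed

section \<open>Dyadic BMO norms\<close>

lemma epowr_mono: "x \<le> y \<Longrightarrow> 0 \<le> r \<Longrightarrow> epowr x r \<le> epowr y r"
  by (auto simp: epowr_def top_unique intro!: ennreal_leI powr_mono2 enn2real_mono)
     (simp add: less_top)

lemma BMO_dyadic_norm_eq_0:
  assumes "\<And>I J. I \<in> dyadic_grid a \<Longrightarrow> J \<in> dyadic_grid b \<Longrightarrow> haar_coeff F I J = 0"
  shows "BMO_dyadic_norm a b F = 0"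
proof -
  have "(\<Sum>\<^sub>\<infinity>(I, J) \<in> {(I, J). I \<in> dyadic_grid a \<and> J \<in> dyadic_grid b \<and>
            {fst I..<snd I} \<times> {fst J..<snd J} \<subseteq> \<Omega>}. ennreal (\<bar>haar_coeff F I J\<bar>\<^sup>2)) = 0" for \<Omega>
    by (rule infsum_0) (auto simp: assms)
  then show ?thesis
    unfolding BMO_dyadic_norm_def by (auto simp: epowr_def SUP_constant bot_ennreal)
qed

text \<open>Test the supremum on a single open set and keep a single rectangle of the sum.\<close>

lemma BMO_dyadic_norm_ge:
  assumes "I \<in> dyadic_grid a" "J \<in> dyadic_grid b" "{fst I..<snd I} \<times> {fst J..<snd J} \<subseteq> \<Omega>"
    and "open \<Omega>" "\<Omega> \<noteq> {}" "emeasure lebesgue \<Omega> = ennreal m" "m > 0"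
  shows "ennreal (\<bar>haar_coeff F I J\<bar> / sqrt m) \<le> BMO_dyadic_norm a b F"
proof -
  define A where "A = {(I, J). I \<in> dyadic_grid a \<and> J \<in> dyadic_grid b \<and>
                                  {fst I..<snd I} \<times> {fst J..<snd J} \<subseteq> \<Omega>}"
  define S where "S = (\<Sum>\<^sub>\<infinity>(I, J) \<in> A. ennreal (\<bar>haar_coeff F I J\<bar>\<^sup>2))"
  \<comment> \<open>The infinite sum in \<open>ennreal\<close> is the supremum of its finite partial
    sums, one of which is over this singleton.\<close>
  have "(\<Sum>(I, J) \<in> {(I, J)}. ennreal (\<bar>haar_coeff F I J\<bar>\<^sup>2)) \<le> S"
    unfolding S_def using assms(1-3) by (subst nonneg_infsum_complete) (auto intro!: SUP_upper2[of "{(I, J)}"] simp: A_def)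
  then have "ennreal (\<bar>haar_coeff F I J\<bar>\<^sup>2) / ennreal m \<le> S / emeasure lebesgue \<Omega>"
    unfolding assms(6) by (intro divide_right_mono_ennreal) auto
  then have "epowr (ennreal (\<bar>haar_coeff F I J\<bar>\<^sup>2) / ennreal m) (1 / 2)
      \<le> epowr (S / emeasure lebesgue \<Omega>) (1 / 2)"
    by (rule epowr_mono) simp
  also have "\<dots> \<le> BMO_dyadic_norm a b F"
    unfolding BMO_dyadic_norm_def S_def A_def using assms by (intro SUP_upper) auto
  also have "epowr (ennreal (\<bar>haar_coeff F I J\<bar>\<^sup>2) / ennreal m) (1 / 2)
      = ennreal (\<bar>haar_coeff F I J\<bar> / sqrt m)"
    using \<open>m > 0\<close>
    by (simp add: epowr_def divide_ennreal powr_half_sqrt real_sqrt_divide)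
  finally show ?thesis .
qed

lemma BMO_norm_fst_eq_0:
  assumes "\<And>x. (G has_real_derivative g x) (at x)" "continuous_on UNIV g"
  shows "BMO_norm \<delta> (\<lambda>z. g (fst z)) = 0"
proof -
  have "BMO_dyadic_norm a b (\<lambda>z. g (fst z)) = 0" for a b
    by (intro BMO_dyadic_norm_eq_0 haar_coeff_fst_eq_0[of G] assms dyadic_grid_less)
  then show ?thesis
    by (simp add: BMO_norm_def)
qed

text \<open>The coefficient grows like sqrt L and so does the root of the area of the test set, so
  the bound does not depend on L. The unshifted grid in both variables suffices.\<close>

lemma BMO_norm_plane_wave_ge:
  assumes "\<alpha> \<noteq> 0" "L = 2 ^ k" "\<beta> = 2 * pi / L"
  shows "ennreal (\<bar>(2 * sin (\<alpha> / 2) - sin \<alpha>) / \<alpha>\<bar> / pi)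
           \<le> BMO_norm \<delta> (\<lambda>z. sin (\<alpha> * fst z - \<beta> * snd z))" (is "_ \<le> BMO_norm \<delta> ?F")
proof -
  have L: "L > 0"
    using assms by simp
  have "(0, 1) \<in> dyadic"
    unfolding dyadic_def by (rule CollectI) (rule exI[of _ 0], rule exI[of _ 0], simp)
  moreover have "(0, L) \<in> dyadic"
    unfolding dyadic_def
    by (rule CollectI) (rule exI[of _ 0], rule exI[of _ "int k"], simp add: assms)
  \<comment> \<open>The half-open dyadic rectangle is enlarged to an open one of area 4L; the
    resulting factor 2 in the root cancels the 2 in \<open>2 * sqrt L / pi\<close>.\<close>
  moreover have "emeasure lebesgue ({-1<..<1::real} \<times> {-L<..<L}) = ennreal (4 * L)"
  proof -
    have "emeasure lebesgue ({-1<..<1::real} \<times> {-L<..<L}) = emeasure (lborel \<Otimes>\<^sub>M lborel) ({-1<..<1::real} \<times> {-L<..<L})"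
      using borel_open[OF open_Times[of "{-1<..<1::real}" "{-L<..<L}"]] by (simp add: lborel_prod)
    also have "\<dots> = ennreal 2 * ennreal (2 * L)"
      using L by (subst lborel.emeasure_pair_measure_Times) auto
    finally show ?thesis
      using L by (simp add: ennreal_mult[symmetric] del: ennreal_numeral)
  qed
  ultimately have "ennreal (\<bar>haar_coeff ?F (0, 1) (0, L)\<bar> / sqrt (4 * L)) \<le> BMO_dyadic_norm 0 0 ?F"
    using L
    by (intro BMO_dyadic_norm_ge[where \<Omega>="{-1<..<1} \<times> {-L<..<L}"])
       (auto simp: dyadic_grid_def open_Times)
  also have "\<dots> \<le> BMO_norm \<delta> ?F"
    unfolding BMO_norm_def by (rule SUP_upper2[of "(0, 0)"]) auto
  also have "\<bar>haar_coeff ?F (0, 1) (0, L)\<bar> / sqrt (4 * L) = \<bar>(2 * sin (\<alpha> / 2) - sin \<alpha>) / \<alpha>\<bar> / pi"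
    using L by (subst haar_coeff_plane_wave[OF assms(1) L assms(3)])
      (simp add: abs_mult real_sqrt_mult)
  finally show ?thesis .
qed

section \<open>The counterexample for rotations\<close>

theorem theorem3p3:
  fixes \<delta>\<^sub>0 :: real and C :: "real \<Rightarrow> real"
  assumes "0 < \<delta>\<^sub>0" and "\<delta>\<^sub>0 < 1 / 2"
  shows "\<exists>p::ennreal. p > 2 \<and>
           (\<exists>F \<in> BMO \<delta>\<^sub>0 \<inter> W1p p.
              \<forall>\<epsilon> :: real \<Rightarrow> ennreal \<Rightarrow> real. (\<forall>\<theta>. \<epsilon> \<theta> p < 1) \<longrightarrow>
                \<not> (((\<lambda>\<theta>. \<epsilon> \<theta> p) \<longlongrightarrow> 0) (at 0) \<and>
                   (\<forall>\<theta>. enn2ereal (BMO_norm \<delta>\<^sub>0 (F \<circ> rot \<theta>))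
                        \<le> ereal (C \<theta>) * enn2ereal (BMO_norm \<delta>\<^sub>0 F)
                           + ereal (\<epsilon> \<theta> p) * enn2ereal (W1p_norm p F))))"
proof (intro exI[of _ \<infinity>] conjI bexI[of _ "\<lambda>z. sin (fst z)"] allI impI notI)
  let ?F = "\<lambda>z :: real \<times> real. sin (fst z)"
  have deriv: "(?F has_derivative (\<lambda>h. fst h * cos (fst z) + snd h * 0)) (at z)" for z
    by (auto intro!: derivative_eq_intros)
  note C1 = W1p_infinity_C1[OF deriv, of 1]
  have W: "?F \<in> W1p \<infinity>" "W1p_norm \<infinity> ?F < \<infinity>"
    by (rule C1; auto intro!: continuous_intros)+
  have "((\<lambda>x. - cos x) has_real_derivative sin x) (at x)" for x :: real
    by (auto intro!: derivative_eq_intros)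
  then have BMO_0: "BMO_norm \<delta>\<^sub>0 ?F = 0"
    by (rule BMO_norm_fst_eq_0) (auto intro!: continuous_intros)
  have "?F \<in> L2_loc"
    by (intro continuous_imp_L2_loc continuous_intros)
  with W BMO_0 show "?F \<in> BMO \<delta>\<^sub>0 \<inter> W1p \<infinity>"
    by (simp add: BMO_def)
  fix \<epsilon> :: "real \<Rightarrow> ennreal \<Rightarrow> real"
  assume "((\<lambda>\<theta>. \<epsilon> \<theta> \<infinity>) \<longlongrightarrow> 0) (at 0) \<and>
     (\<forall>\<theta>. enn2ereal (BMO_norm \<delta>\<^sub>0 (?F \<circ> rot \<theta>))
        \<le> ereal (C \<theta>) * enn2ereal (BMO_norm \<delta>\<^sub>0 ?F) + ereal (\<epsilon> \<theta> \<infinity>) * enn2ereal (W1p_norm \<infinity> ?F))"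
  \<comment> \<open>With BMO norm 0 the first term is \<open>ereal (C \<theta>) * 0 = 0\<close>,
    whatever the sign and size of \<open>C \<theta>\<close>.\<close>
  then have \<epsilon>: "((\<lambda>\<theta>. \<epsilon> \<theta> \<infinity>) \<longlongrightarrow> 0) (at 0)" and
    le: "\<And>\<theta>. enn2ereal (BMO_norm \<delta>\<^sub>0 (?F \<circ> rot \<theta>)) \<le> ereal (\<epsilon> \<theta> \<infinity>) * enn2ereal (W1p_norm \<infinity> ?F)"
    by (simp_all add: BMO_0 zero_ennreal.rep_eq)
  obtain w where w: "W1p_norm \<infinity> ?F = ennreal w" "w \<ge> 0"
    using W(2) by (cases "W1p_norm \<infinity> ?F") auto
  define A where "A \<alpha> = (2 * sin (\<alpha> / 2) - sin \<alpha>) / \<alpha>" for \<alpha> :: real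
  define \<theta> where "\<theta> k = arcsin (2 * pi / 2 ^ k)" for k :: nat
  have lim_\<beta>: "(\<lambda>k. 2 * pi / 2 ^ k :: real) \<longlonglongrightarrow> 0"
    by real_asymp
  have "(\<lambda>k. arcsin (2 * pi / 2 ^ k)) \<longlonglongrightarrow> arcsin 0"
    by (rule isCont_tendsto_compose[OF isCont_arcsin lim_\<beta>]) auto
  then have lim_\<theta>: "\<theta> \<longlonglongrightarrow> 0"
    by (simp add: \<theta>_def[abs_def])
  \<comment> \<open>\<open>arcsin\<close> inverts the sine only on [-1, 1], so the prescribed value
    of \<open>sin (\<theta> k)\<close> is available only for large k.\<close>
  have small: "eventually (\<lambda>k. 2 * pi / 2 ^ k < (1 :: real)) sequentially"
    using order_tendstoD(2)[OF lim_\<beta>, of 1] by simp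
  then have sin_\<theta>: "eventually (\<lambda>k. sin (\<theta> k) = 2 * pi / 2 ^ k) sequentially"
  proof eventually_elim
    case (elim k)
    have "0 \<le> 2 * pi / 2 ^ k"
      by simp
    with elim show ?case
      unfolding \<theta>_def by (intro sin_arcsin) linarith+
  qed
  \<comment> \<open>The limit of \<epsilon> is taken along the punctured filter \<open>at 0\<close>,
    so the angles must avoid 0.\<close>
  then have "eventually (\<lambda>k. \<theta> k \<noteq> 0) sequentially"
  proof eventually_elim
    case (elim k)
    then show ?case
      by (cases "\<theta> k = 0") auto
  qed
  with lim_\<theta> have "filterlim \<theta> (at 0) sequentially"
    by (simp add: filterlim_at)
  from tendsto_mult_right[OF filterlim_compose[OF \<epsilon> this], of w]
  have lim_\<epsilon>: "(\<lambda>k. \<epsilon> (\<theta> k) \<infinity> * w) \<longlonglongrightarrow> 0"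
    by (simp add: mult.commute)
  have lim_cos: "(\<lambda>k. cos (\<theta> k)) \<longlonglongrightarrow> 1"
    using tendsto_cos[OF lim_\<theta>] by simp
  have lim_A: "(\<lambda>k. \<bar>A (cos (\<theta> k))\<bar> / pi) \<longlonglongrightarrow> \<bar>A 1\<bar> / pi"
    unfolding A_def by (intro tendsto_intros lim_cos) auto
  \<comment> \<open>The double-angle formula exhibits the limiting lower bound as a product of
    positive factors.\<close>
  have "A 1 = 2 * sin (1 / 2) * (1 - cos (1 / 2))"
    using sin_double[of "1 / 2 :: real"] by (simp add: A_def algebra_simps)
  moreover have "sin (1 / 2 :: real) > 0"
    using pi_gt3 by (intro sin_gt_zero) auto
  moreover have "cos (1 / 2 :: real) < cos 0"
    using pi_gt3 by (intro cos_monotone_0_pi) auto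
  ultimately have "\<bar>A 1\<bar> / pi > 0"
    by simp
  then have "eventually (\<lambda>k. 0 < \<bar>A (cos (\<theta> k))\<bar> / pi - \<epsilon> (\<theta> k) \<infinity> * w) sequentially"
    using order_tendstoD(1)[OF tendsto_diff[OF lim_A lim_\<epsilon>], of 0] by simp
  moreover have "eventually (\<lambda>k. cos (\<theta> k) \<noteq> 0) sequentially"
    using lim_cos by (rule tendsto_imp_eventually_ne) simp
  \<comment> \<open>For large k the lower bound, which has a positive limit, exceeds the upper
    bound, which tends to 0.\<close>
  ultimately have "eventually (\<lambda>k. False) sequentially"
    using sin_\<theta>
  proof eventually_elim
    case (elim k)
    have "ennreal (\<bar>A (cos (\<theta> k))\<bar> / pi)
        \<le> BMO_norm \<delta>\<^sub>0 (\<lambda>z. sin (cos (\<theta> k) * fst z - sin (\<theta> k) * snd z))"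
      unfolding A_def using elim by (intro BMO_norm_plane_wave_ge[OF _ refl]) auto
    also have "(\<lambda>z. sin (cos (\<theta> k) * fst z - sin (\<theta> k) * snd z)) = ?F \<circ> rot (\<theta> k)"
      by (auto simp: rot_def)
    finally have "ereal (\<bar>A (cos (\<theta> k))\<bar> / pi) \<le> enn2ereal (BMO_norm \<delta>\<^sub>0 (?F \<circ> rot (\<theta> k)))"
      by (simp add: less_eq_ennreal.rep_eq enn2ereal_ennreal o_def)
    also have "\<dots> \<le> ereal (\<epsilon> (\<theta> k) \<infinity> * w)"
      using le[of "\<theta> k"] w by (simp add: enn2ereal_ennreal)
    finally show False
      using elim by simp
  qed
  then show False
    by simp
qed simp

end
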